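(* Let $C$ be a closed convex cone in $H$, $K$ a nonempty closed convex set in $H$, and $g:H\to H$ and $f:C\to H$ two continuous mappings with $g^{-1}(K)\subseteq C$. For $\hat x\in H$ and $r>\|\Pi_K(\hat x)\|$ put $\Omega^{\hat x}_r:=\{x\in H\mid \|g(x)\|<r\}$. Suppose that (a) the boundedness of $\|g(x)\|$ implies the boundedness of $\|x\|$ (i.e. for every $M\ge 0$ the set $\{x\in H\mid \|g(x)\|\le M\}$ is bounded); and (b) for any given $\hat x\in H$ and every $r>\|\Pi_K(\hat x)\|$, the degree $\deg(g,\Omega^{\hat x}_r,\Pi_K(\hat x))$ is defined and nonzero. Then, for any given $\hat x\in H$, either GVI$(f,g,K)$ has a solution or there exists an exceptional family of elements for the pair $(f,g)$ with respect to $\hat x$.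
   Context: $H$ is a finite dimensional real Hilbert space with inner product $\langle\cdot,\cdot\rangle$ and norm $\|\cdot\|$. $\Pi_K$ is the orthogonal projection onto the closed convex set $K$. $g^{-1}(K)=\{x\in H\mid g(x)\in K\}$. The normal cone of $K$ at $z\in K$ is $\mathcal N_K(z):=\{u\in H\mid \langle u,y-z\rangle\le 0\ \forall y\in K\}$, and $\mathcal N_K(z):=\emptyset$ if $z\notin K$. GVI$(f,g,K)$ is the problem of finding $x^*\in H$ such that $g(x^* )\in K$ and $\langle f(x^* ),y-g(x^* )\rangle\ge 0$ for all $y\in K$ (such $x^*$ lies in $g^{-1}(K)\subseteq C$, so $f(x^* )$ is defined). $\deg(\phi,\Omega,b)$ is the topological (Brouwer) degree; it is defined when $\Omega\subset H$ is bounded and open, $\phi:\bar\Omega\to H$ is continuous, and $b\notin\phi(\partial\Omega)$. Exceptional family of elements: let $g:H\to H$ and $f:D\to H$ be continuous, with $D\subseteq H$ nonempty and $g^{-1}(K)\subseteq D$ (here $D=C$). A set of points $\{x^r\}_{r>0}\subset D$ is an exceptional family of elements for the pair $(f,g)$ with respect to $\hat x\in H$ if (i) $\|x^r\|\to\infty$ as $r\to\infty$; (ii) $g(x^r)\in K$ for any $r>0$; (iii) for any $r>\|\Pi_K(\hat x)\|$ there exists a real number $\alpha_r>0$ such that $-[f(x^r)+\alpha_r(g(x^r)-\hat x)]\in\mathcal N_K(g(x^r))$. *)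

theory Defs
  imports "HOL-Homology.Homology"
begin

section \<open>Brouwer degree\<close>

text \<open>
  The library provides the degree \<^term>\<open>Brouwer_degree2 n\<close> of a self-map of the \<open>n\<close>-sphere
  \<^term>\<open>nsphere n\<close>. The degree \<open>deg(\<phi>, \<Omega>, b)\<close> of a map on the closure of a bounded open set is
  obtained from it by one-point compactification: if \<open>b\<close> is not attained on the boundary of \<open>\<Omega>\<close>,
  then \<open>\<psi>(x) = (\<phi>(x) - b) / dist(x, - \<Omega>)\<close> is a proper map from \<open>\<Omega>\<close> to the whole space, i.e.
  \<open>\<psi>(x)\<close> tends to infinity as \<open>x\<close> approaches the boundary. It is a positive multiple of \<open>\<phi> - b\<close>, so
  it has the same zeros with the same local degrees. Sending everything outside \<open>\<Omega>\<close> to infinity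
  therefore yields a continuous self-map of the one-point compactification of the space, and the
  latter is identified with the sphere by stereographic projection.
\<close>

text \<open>The same coordinates are used in source and target, so their choice (and its orientation)
  does not affect the degree.\<close>

definition basis_enum :: "nat \<Rightarrow> 'a::euclidean_space" where
  "basis_enum = (SOME e. bij_betw e {..<DIM('a)} Basis)"

definition sphere_pole :: "nat \<Rightarrow> nat \<Rightarrow> real" where
  "sphere_pole n = (\<lambda>i. if i = n then 1 else 0)"

definition to_sphere :: "'a::euclidean_space \<Rightarrow> nat \<Rightarrow> real" where
  "to_sphere v = (\<lambda>i. if i < DIM('a) then 2 * (v \<bullet> basis_enum i) / ((norm v)\<^sup>2 + 1)
                      else if i = DIM('a) then ((norm v)\<^sup>2 - 1) / ((norm v)\<^sup>2 + 1)
                      else 0)"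

definition from_sphere :: "(nat \<Rightarrow> real) \<Rightarrow> 'a::euclidean_space" where
  "from_sphere s = (\<Sum>i<DIM('a). (s i / (1 - s DIM('a))) *\<^sub>R basis_enum i)"

definition compactified_map ::
    "('a::euclidean_space \<Rightarrow> 'a) \<Rightarrow> 'a set \<Rightarrow> 'a \<Rightarrow> (nat \<Rightarrow> real) \<Rightarrow> nat \<Rightarrow> real" where
  "compactified_map \<phi> \<Omega> b s =
     (let x = from_sphere s in
      if s \<noteq> sphere_pole DIM('a) \<and> x \<in> \<Omega>
      then to_sphere ((\<phi> x - b) /\<^sub>R infdist x (- \<Omega>))
      else sphere_pole DIM('a))"

definition degree_defined :: "('a::euclidean_space \<Rightarrow> 'a) \<Rightarrow> 'a set \<Rightarrow> 'a \<Rightarrow> bool" where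
  "degree_defined \<phi> \<Omega> b \<longleftrightarrow>
     bounded \<Omega> \<and> open \<Omega> \<and> continuous_on (closure \<Omega>) \<phi> \<and> b \<notin> \<phi> ` frontier \<Omega>"

definition brouwer_degree :: "('a::euclidean_space \<Rightarrow> 'a) \<Rightarrow> 'a set \<Rightarrow> 'a \<Rightarrow> int" where
  "brouwer_degree \<phi> \<Omega> b = Brouwer_degree2 DIM('a) (compactified_map \<phi> \<Omega> b)"

section \<open>Variational inequalities and exceptional families\<close>

definition normal_cone :: "'a::real_inner set \<Rightarrow> 'a \<Rightarrow> 'a set" where
  "normal_cone K z = (if z \<in> K then {u. \<forall>y\<in>K. u \<bullet> (y - z) \<le> 0} else {})"

definition GVI_solution ::
    "('a::real_inner \<Rightarrow> 'a) \<Rightarrow> ('a \<Rightarrow> 'a) \<Rightarrow> 'a set \<Rightarrow> 'a \<Rightarrow> bool" where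
  "GVI_solution f g K x \<longleftrightarrow> g x \<in> K \<and> (\<forall>y\<in>K. f x \<bullet> (y - g x) \<ge> 0)"

text \<open>The orthogonal projection onto \<open>K\<close> is \<^term>\<open>closest_point K\<close>. \<open>D\<close> is the domain of \<open>f\<close>;
  the values of the family \<open>x\<close> at indices \<open>r \<le> 0\<close> are irrelevant.\<close>

definition exceptional_family ::
    "('a::euclidean_space \<Rightarrow> 'a) \<Rightarrow> ('a \<Rightarrow> 'a) \<Rightarrow> 'a set \<Rightarrow> 'a set \<Rightarrow> 'a \<Rightarrow> (real \<Rightarrow> 'a) \<Rightarrow> bool" where
  "exceptional_family f g D K xhat x \<longleftrightarrow>
     (\<forall>r>0. x r \<in> D) \<and>
     filterlim (\<lambda>r. norm (x r)) at_top at_top \<and>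
     (\<forall>r>0. g (x r) \<in> K) \<and>
     (\<forall>r>norm (closest_point K xhat).
        \<exists>\<alpha>>0. - (f (x r) + \<alpha> *\<^sub>R (g (x r) - xhat)) \<in> normal_cone K (g (x r)))"

section \<open>Brouwer degree: normalisation, existence and homotopy invariance\<close>

abbreviation sph :: "nat \<Rightarrow> (nat \<Rightarrow> real) set" where
  "sph n \<equiv> {x. (\<Sum>i\<le>n. x i ^ 2) = 1 \<and> (\<forall>i>n. x i = 0)}"

lemma nsphere_top: "nsphere n = top_of_set (sph n)"
  by (simp add: nsphere euclidean_product_topology)

lemma basis_enum_bij: "bij_betw (basis_enum :: nat \<Rightarrow> 'a::euclidean_space) {..<DIM('a)} Basis"
proof -
  obtain e :: "nat \<Rightarrow> 'a" where "bij_betw e {0..<DIM('a)} Basis"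
    using ex_bij_betw_nat_finite[OF finite_Basis] by blast
  then have "\<exists>e :: nat \<Rightarrow> 'a. bij_betw e {..<DIM('a)} Basis" by (metis atLeast0LessThan)
  then show ?thesis unfolding basis_enum_def by (rule someI_ex)
qed

lemma sum_enum: "(\<Sum>i<DIM('a). h (basis_enum i :: 'a::euclidean_space)) = (\<Sum>u\<in>Basis. h u)"
  using sum.reindex_bij_betw[OF basis_enum_bij] by blast

lemma inner_enum: "i < DIM('a) \<Longrightarrow> j < DIM('a) \<Longrightarrow>
   (basis_enum i :: 'a::euclidean_space) \<bullet> basis_enum j = (if i = j then 1 else 0)"
  using basis_enum_bij[where 'a='a] inner_Basis[of "basis_enum i :: 'a" "basis_enum j"]
  by (metis (no_types, lifting) bij_betw_def inj_on_eq_iff imageI lessThan_iff)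

lemma norm_enum: "(\<Sum>i<DIM('a). ((v::'a::euclidean_space) \<bullet> basis_enum i)^2) = (norm v)^2"
  using sum_enum[of "\<lambda>u. (v \<bullet> u)^2"] 
  by (simp add: power2_norm_eq_inner) (simp add: euclidean_inner[of v v] power2_eq_square)

lemma rep_enum: "(\<Sum>i<DIM('a). ((v::'a::euclidean_space) \<bullet> basis_enum i) *\<^sub>R basis_enum i) = v"
  using sum_enum[of "\<lambda>u. (v \<bullet> u) *\<^sub>R u"] by (simp add: euclidean_representation)

lemma sum_sq_if:
  "(\<Sum>i\<le>(n::nat). (if i < n then p i else if i = n then q else 0)^2) = (\<Sum>i<n. (p i)^2) + (q::real)^2"
proof -
  have "(\<Sum>i\<le>n. (if i < n then p i else if i = n then q else 0)^2)
     = (\<Sum>i<n. (if i < n then p i else if i = n then q else 0)^2) + q^2"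
    unfolding lessThan_Suc_atMost[symmetric] by simp
  also have "(\<Sum>i<n. (if i < n then p i else if i = n then q else 0)^2) = (\<Sum>i<n. (p i)^2)"
    by (intro sum.cong) auto
  finally show ?thesis .
qed


text \<open>The point of the sphere with stereographic coordinate \<open>w / d\<close>, which is the pole for \<open>d = 0\<close>.\<close>

definition proj_point :: "'a::euclidean_space \<Rightarrow> real \<Rightarrow> nat \<Rightarrow> real" where
  "proj_point w d = (\<lambda>i. if i < DIM('a) then 2 * d * (w \<bullet> basis_enum i) / ((norm w)\<^sup>2 + d\<^sup>2)
                      else if i = DIM('a) then ((norm w)\<^sup>2 - d\<^sup>2) / ((norm w)\<^sup>2 + d\<^sup>2)
                      else 0)"

lemma norm_sq_pos: "w \<noteq> 0 \<or> d \<noteq> 0 \<Longrightarrow> (norm w)\<^sup>2 + (d::real)\<^sup>2 > 0"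
  by (metis norm_eq_zero sum_power2_gt_zero_iff)

lemma proj_point_in: assumes "(w::'a::euclidean_space) \<noteq> 0 \<or> d \<noteq> 0" shows "proj_point w d \<in> sph DIM('a)"
proof -
  let ?q = "(norm w)\<^sup>2 + d\<^sup>2"
  have q: "?q > 0" using norm_sq_pos[OF assms] .
  have "(\<Sum>i<DIM('a). (2 * d * (w \<bullet> basis_enum i) / ?q)^2) = (\<Sum>i<DIM('a). (2*d/?q)^2 * (w \<bullet> basis_enum i)^2)"
    by (intro sum.cong) (auto simp: power_mult_distrib power_divide)
  also have "\<dots> = (2*d/?q)^2 * (norm w)^2" by (simp add: sum_distrib_left[symmetric] norm_enum)
  finally have "(\<Sum>i\<le>DIM('a). (proj_point w d i)^2) = (2*d/?q)^2 * (norm w)^2 + (((norm w)\<^sup>2 - d\<^sup>2) / ?q)^2"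
    unfolding proj_point_def sum_sq_if by simp
  also have "(2*d/?q)^2 * (norm w)^2 + (((norm w)\<^sup>2 - d\<^sup>2) / ?q)^2 
      = ((2*d)^2 * (norm w)^2 + ((norm w)\<^sup>2 - d\<^sup>2)^2) / ?q^2"
    by (simp add: power_divide add_divide_distrib)
  also have "(2*d)^2 * (norm w)^2 + ((norm w)\<^sup>2 - d\<^sup>2)^2 = ?q^2" by (simp add: power2_eq_square algebra_simps)
  finally have "(\<Sum>i\<le>DIM('a). (proj_point w d i)^2) = 1" using q assms by auto
  then show ?thesis by (simp add: proj_point_def)
qed

lemma proj_point_to_sphere: "d > 0 \<Longrightarrow> to_sphere (w /\<^sub>R d) = proj_point w d"
  by (rule ext) (auto simp: to_sphere_def proj_point_def divide_simps power2_eq_square)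

lemma proj_point_pole: "w \<noteq> 0 \<Longrightarrow> proj_point (w::'a::euclidean_space) 0 = sphere_pole DIM('a)"
  by (auto simp: proj_point_def sphere_pole_def)

lemma pole_in: "sphere_pole n \<in> sph n"
  unfolding sphere_pole_def by (auto simp: if_distrib power2_eq_square cong: if_cong)

lemma to_sphere_proj_point: "to_sphere v = proj_point v 1"
  using proj_point_to_sphere[of 1 v] by simp

lemma to_sphere_in: "to_sphere (v::'a::euclidean_space) \<in> sph DIM('a)"
  unfolding to_sphere_proj_point by (rule proj_point_in) simp

lemma to_sphere_neq: "to_sphere (v::'a::euclidean_space) \<noteq> sphere_pole DIM('a)"
proof
  assume "to_sphere v = sphere_pole DIM('a)"
  then have "to_sphere v DIM('a) = 1" by (simp add: sphere_pole_def)
  then show False using norm_sq_pos[of v 1] by (simp add: to_sphere_def)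
qed

lemma from_to [simp]: "from_sphere (to_sphere (v::'a::euclidean_space)) = v"
proof -
  let ?q = "(norm v)\<^sup>2 + 1"
  have q: "?q > 0" using norm_sq_pos[of v 1] by simp
  have "1 - to_sphere v DIM('a) = 2 / ?q" using q by (simp add: to_sphere_def field_simps)
  then have "to_sphere v i / (1 - to_sphere v DIM('a)) = v \<bullet> basis_enum i" if "i < DIM('a)" for i
    using that q by (simp add: to_sphere_def)
  then have "(from_sphere (to_sphere v) :: 'a) = (\<Sum>i<DIM('a). (v \<bullet> basis_enum i) *\<^sub>R basis_enum i)"
    unfolding from_sphere_def by (intro sum.cong) auto
  then show ?thesis by (simp add: rep_enum)
qed

lemma pole_iff: assumes "s \<in> sph n" shows "s = sphere_pole n \<longleftrightarrow> s n = 1"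
proof
  assume "s n = 1"
  have "(\<Sum>i<n. (s i)^2) = 0" using assms \<open>s n = 1\<close> by (simp add: lessThan_Suc_atMost[symmetric])
  then have "s i = 0" if "i < n" for i using that by (simp add: sum_nonneg_eq_0_iff)
  then show "s = sphere_pole n" using assms \<open>s n = 1\<close> 
    by (auto simp: sphere_pole_def fun_eq_iff) (metis linorder_neqE_nat)
qed (simp add: sphere_pole_def)

lemma from_enum: "i < DIM('a) \<Longrightarrow> (from_sphere s :: 'a::euclidean_space) \<bullet> basis_enum i = s i / (1 - s DIM('a))"
  unfolding from_sphere_def inner_sum_left
  by (subst sum.remove[of _ i]) (auto simp: inner_enum intro!: sum.neutral)

lemma norm_from: 
  assumes "s \<in> sph DIM('a)" "s \<noteq> sphere_pole DIM('a)"
  shows "(norm (from_sphere s :: 'a::euclidean_space))^2 = (1 + s DIM('a)) / (1 - s DIM('a))"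
proof -
  let ?z = "s DIM('a)"
  have z: "?z \<noteq> 1" using assms pole_iff by blast
  have "(norm (from_sphere s :: 'a))^2 = (\<Sum>i<DIM('a). (s i / (1 - ?z))^2)"
    unfolding norm_enum[symmetric] by (intro sum.cong) (auto simp: from_enum)
  also have "\<dots> = (\<Sum>i<DIM('a). (s i)^2) / (1 - ?z)^2" by (simp add: power_divide sum_divide_distrib)
  also have "(\<Sum>i<DIM('a). (s i)^2) = 1 - ?z^2" using assms by (simp add: lessThan_Suc_atMost[symmetric])
  also have "1 - ?z^2 = (1 - ?z) * (1 + ?z)" by (simp add: power2_eq_square algebra_simps)
  finally show ?thesis using z by (simp add: power2_eq_square)
qed

lemma to_from: 
  assumes "s \<in> sph DIM('a)" "s \<noteq> sphere_pole DIM('a)"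
  shows "to_sphere (from_sphere s :: 'a::euclidean_space) = s"
proof
  fix i
  let ?z = "s DIM('a)"
  have z: "?z \<noteq> 1" using assms pole_iff by blast
  have q: "(norm (from_sphere s :: 'a))^2 + 1 = 2 / (1 - ?z)" "(norm (from_sphere s :: 'a))^2 - 1 = 2 * ?z / (1 - ?z)" 
    unfolding norm_from[OF assms] using z by (auto simp: field_simps)
  show "to_sphere (from_sphere s :: 'a) i = s i"
    unfolding to_sphere_def q using assms z by (auto simp: from_enum)
qed

lemma closed_sph: "closed (sph n)"
  unfolding Collect_conj_eq Collect_all_eq
  by (intro closed_Int closed_INT closed_Collect_eq ballI closed_Collect_imp continuous_intros continuous_on_product_coordinates)
     (auto intro!: closed_Collect_imp closed_Collect_eq continuous_intros continuous_on_product_coordinates)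

lemma cont_coord: "continuous_on S (\<lambda>s::nat\<Rightarrow>real. s i)"
  by (rule continuous_on_subset[OF continuous_on_product_coordinates]) simp

lemma cont_to: "continuous_on S (to_sphere :: 'a::euclidean_space \<Rightarrow> _)"
proof (rule continuous_on_coordinatewise_then_product)
  fix i
  have "(norm x)\<^sup>2 + 1 \<noteq> 0" for x :: 'a using norm_sq_pos[of x 1] by simp
  then show "continuous_on S (\<lambda>x::'a. to_sphere x i)"
    unfolding to_sphere_def by (cases "i < DIM('a)"; cases "i = DIM('a)") (auto intro!: continuous_intros)
qed

lemma cont_proj_point: 
  assumes "continuous_on S w" "continuous_on S d" "\<And>x. x \<in> S \<Longrightarrow> (w x::'a::euclidean_space) \<noteq> 0 \<or> d x \<noteq> 0"
  shows "continuous_on S (\<lambda>x. proj_point (w x) (d x))"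
proof (rule continuous_on_coordinatewise_then_product)
  fix i
  have "\<forall>x\<in>S. (norm (w x))\<^sup>2 + (d x)\<^sup>2 \<noteq> 0" using norm_sq_pos assms(3) by (metis less_irrefl)
  then show "continuous_on S (\<lambda>x. proj_point (w x) (d x) i)"
    unfolding proj_point_def by (cases "i < DIM('a)"; cases "i = DIM('a)") (auto intro!: continuous_intros assms)
qed

lemma cont_from: 
  assumes "\<And>s. s \<in> S \<Longrightarrow> s DIM('a) \<noteq> 1" 
  shows "continuous_on S (from_sphere :: _ \<Rightarrow> 'a::euclidean_space)"
  unfolding from_sphere_def using assms by (auto intro!: continuous_intros cont_coord)

lemma comp_homotopy_cont:
  fixes h :: "real \<Rightarrow> 'a::euclidean_space \<Rightarrow> 'a"
  assumes \<Omega>: "bounded \<Omega>" "open \<Omega>" 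
    and h: "continuous_on ({0..1} \<times> closure \<Omega>) (\<lambda>(t,x). h t x)"
    and b: "continuous_on {0..1} b"
    and bd: "\<And>t x. t \<in> {0..1} \<Longrightarrow> x \<in> frontier \<Omega> \<Longrightarrow> h t x \<noteq> b t"
  shows "continuous_on ({0..1} \<times> sph DIM('a)) (\<lambda>(t,s). compactified_map (h t) \<Omega> (b t) s)"
    and "\<And>t s. t \<in> {0..1} \<Longrightarrow> s \<in> sph DIM('a) \<Longrightarrow> compactified_map (h t) \<Omega> (b t) s \<in> sph DIM('a)"
proof -
  let ?n = "DIM('a)" and ?d = "\<lambda>x. infdist x (- \<Omega>)"
  let ?I = "{0..1} :: real set"
  have "\<Omega> \<noteq> UNIV" using \<Omega>(1) not_bounded_UNIV by auto
  then have ne: "- \<Omega> \<noteq> {}" by auto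
  have cl: "closed (- \<Omega>)" using \<Omega> by auto
  have d0: "?d x = 0 \<longleftrightarrow> x \<notin> \<Omega>" for x using in_closed_iff_infdist_zero[OF cl ne] by auto
  have dpos: "?d x > 0" if "x \<in> \<Omega>" for x using d0[of x] that infdist_nonneg[of x "- \<Omega>"] by linarith
  have wd: "h t x - b t \<noteq> 0 \<or> ?d x \<noteq> 0" if "t \<in> ?I" "x \<in> closure \<Omega>" for t x
    using that bd[of t x] d0[of x] \<Omega>(2) by (auto simp: frontier_def interior_open)
  define A where "A = to_sphere ` closure \<Omega>"
  define B where "B = sph ?n - to_sphere ` \<Omega>"
  have cA: "closed A" unfolding A_def 
    by (intro compact_imp_closed compact_continuous_image cont_to) (use \<Omega> in auto)
  have Apole: "s ?n \<noteq> 1" if "s \<in> A" for s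
    using that pole_iff[OF to_sphere_in] to_sphere_neq unfolding A_def by blast
  have cB: "closed B"
  proof -
    define S0 where "S0 = {s. s ?n \<noteq> (1::real)}"
    have "open S0" unfolding S0_def using cont_coord[of UNIV ?n] by (intro open_Collect_neq) (auto intro: continuous_intros)
    moreover have "continuous_on S0 (from_sphere :: _ \<Rightarrow> 'a)" by (rule cont_from) (simp add: S0_def)
    ultimately have op: "open (S0 \<inter> from_sphere -` \<Omega>)" using \<Omega>(2) continuous_open_preimage by blast
    have "B = sph ?n - (S0 \<inter> from_sphere -` \<Omega>)"
    proof -
      have "s \<in> to_sphere ` \<Omega> \<longleftrightarrow> s \<in> S0 \<inter> from_sphere -` \<Omega>" if s: "s \<in> sph ?n" for s
      proof
        assume "s \<in> to_sphere ` \<Omega>" then show "s \<in> S0 \<inter> from_sphere -` \<Omega>" using Apole closure_subset unfolding A_def S0_def by fastforce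
      next
        assume s': "s \<in> S0 \<inter> from_sphere -` \<Omega>"
        then have "to_sphere (from_sphere s :: 'a) = s" using to_from[OF s] pole_iff[OF s] unfolding S0_def by blast
        then show "s \<in> to_sphere ` \<Omega>" using s' by force
      qed
      then show ?thesis unfolding B_def by blast
    qed
    then show ?thesis using closed_Diff[OF closed_sph op] by (simp only:)
  qed
  have fA: "compactified_map (h t) \<Omega> (b t) s = proj_point (h t (from_sphere s) - b t) (?d (from_sphere s))"
    if t: "t \<in> ?I" and s: "s \<in> A" for t s
  proof -
    obtain x where x: "x \<in> closure \<Omega>" "s = to_sphere x" using s unfolding A_def by blast
    show ?thesis
    proof (cases "x \<in> \<Omega>")
      case True then show ?thesis using x to_sphere_neq[of x] dpos[of x] by (simp add: compactified_map_def proj_point_to_sphere)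
    next
      case False 
      then show ?thesis using wd[OF t x(1)] d0[of x] x by (simp add: compactified_map_def proj_point_pole)
    qed
  qed
  have fB: "compactified_map (h t) \<Omega> (b t) s = sphere_pole ?n" if "s \<in> B" for t s
    using that to_from[where 'a='a, of s] unfolding B_def compactified_map_def Let_def by (auto) (metis image_eqI)
  have sAB: "sph ?n = A \<union> B"
    unfolding A_def B_def using to_sphere_in closure_subset[of \<Omega>] by (fastforce simp del: mem_Collect_eq)
  have fr: "from_sphere s \<in> closure \<Omega>" if "s \<in> A" for s using that unfolding A_def by auto
  have "continuous_on (?I \<times> A) (\<lambda>p. proj_point (h (fst p) (from_sphere (snd p)) - b (fst p)) (?d (from_sphere (snd p))))"
  proof (rule cont_proj_point)
    have "continuous_on A (from_sphere :: _ \<Rightarrow> 'a)" by (rule cont_from) (rule Apole)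
    then have fs: "continuous_on (?I \<times> A) (\<lambda>p. from_sphere (snd p) :: 'a)"
      by (rule continuous_on_compose2[OF _ continuous_on_snd[OF continuous_on_id]]) auto
    have "continuous_on (?I \<times> A) (\<lambda>p. (\<lambda>(t,x). h t x) (fst p, from_sphere (snd p)))"
      by (rule continuous_on_compose2[OF h]) (use fs fr in \<open>auto intro!: continuous_intros\<close>)
    moreover have "continuous_on (?I \<times> A) (\<lambda>p. b (fst p))"
      by (rule continuous_on_compose2[OF b]) (auto intro!: continuous_intros)
    ultimately show "continuous_on (?I \<times> A) (\<lambda>p. h (fst p) (from_sphere (snd p)) - b (fst p))"
      by (auto intro!: continuous_intros)
    show "continuous_on (?I \<times> A) (\<lambda>p. ?d (from_sphere (snd p)))" using fs by (intro continuous_intros)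
  qed (use wd fr in auto)
  then have "continuous_on (?I \<times> A) (\<lambda>(t,s). compactified_map (h t) \<Omega> (b t) s)"
    by (rule continuous_on_eq) (auto simp: fA)
  moreover have "continuous_on (?I \<times> B) (\<lambda>(t,s). compactified_map (h t) \<Omega> (b t) s)"
    by (rule continuous_on_eq[OF continuous_on_const[of _ "sphere_pole ?n"]]) (auto simp: fB)
  ultimately have "continuous_on (?I \<times> A \<union> ?I \<times> B) (\<lambda>(t,s). compactified_map (h t) \<Omega> (b t) s)"
    using cA cB by (intro continuous_on_closed_Un closed_Times) auto
  then show "continuous_on (?I \<times> sph ?n) (\<lambda>(t,s). compactified_map (h t) \<Omega> (b t) s)"
    by (simp only: sAB Sigma_Un_distrib2)
  fix t s assume ts: "t \<in> ?I" "s \<in> sph ?n"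
  show "compactified_map (h t) \<Omega> (b t) s \<in> sph ?n"
  proof (cases "s \<in> A")
    case True show ?thesis unfolding fA[OF ts(1) True] by (rule proj_point_in) (rule wd[OF ts(1) fr[OF True]])
  next
    case False then have "s \<in> B" using ts sAB by blast
    then show ?thesis unfolding fB[OF \<open>s \<in> B\<close>] by (intro pole_in)
  qed
qed

lemma homotopic_with_canon_TrueI:
  assumes "continuous_on ({0..1::real} \<times> S) (\<lambda>(t,s). F t s)"
    and "\<And>t s. t \<in> {0..1} \<Longrightarrow> s \<in> S \<Longrightarrow> F t s \<in> T"
  shows "homotopic_with_canon (\<lambda>_. True) S T (F 0) (F 1)"
  unfolding homotopic_with_def
  by (rule exI[of _ "\<lambda>(t,s). F t s"]) (use assms in auto)

lemma brouwer_degree_homotopy: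
  fixes h :: "real \<Rightarrow> 'a::euclidean_space \<Rightarrow> 'a"
  assumes \<Omega>: "bounded \<Omega>" "open \<Omega>" 
    and h: "continuous_on ({0..1} \<times> closure \<Omega>) (\<lambda>(t,x). h t x)"
    and b: "continuous_on {0..1} b"
    and bd: "\<And>t x. t \<in> {0..1} \<Longrightarrow> x \<in> frontier \<Omega> \<Longrightarrow> h t x \<noteq> b t"
  shows "brouwer_degree (h 0) \<Omega> (b 0) = brouwer_degree (h 1) \<Omega> (b 1)"
  unfolding brouwer_degree_def
proof (rule Brouwer_degree2_homotopic, unfold nsphere_top)
  show "homotopic_with_canon (\<lambda>x. True) (sph DIM('a)) (sph DIM('a))
     (compactified_map (h 0) \<Omega> (b 0)) (compactified_map (h 1) \<Omega> (b 1))"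
    by (rule homotopic_with_canon_TrueI[where F = "\<lambda>t. compactified_map (h t) \<Omega> (b t)"])
       (rule comp_homotopy_cont[OF assms]; assumption)+
qed

lemma brouwer_degree_solution:
  assumes "degree_defined \<phi> \<Omega> (b::'a::euclidean_space)" "brouwer_degree \<phi> \<Omega> b \<noteq> 0"
  shows "\<exists>x\<in>\<Omega>. \<phi> x = b"
proof (rule ccontr)
  assume no: "\<not> ?thesis"
  have *: "bounded \<Omega>" "open \<Omega>" "continuous_on ({0..1::real} \<times> closure \<Omega>) (\<lambda>(t,x). \<phi> x)"
    "continuous_on {0..1::real} (\<lambda>_. b)" "\<And>t x. t \<in> {0..1::real} \<Longrightarrow> x \<in> frontier \<Omega> \<Longrightarrow> \<phi> x \<noteq> b"
    using assms(1) unfolding degree_defined_def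
    by (auto simp: case_prod_unfold intro!: continuous_on_compose2[of "closure \<Omega>" \<phi> _ snd] continuous_intros)
  note c = comp_homotopy_cont[where h = "\<lambda>_. \<phi>" and b = "\<lambda>_. b", OF *]
  have "continuous_on (sph DIM('a)) (\<lambda>s. (\<lambda>(t::real,s). compactified_map \<phi> \<Omega> b s) (0,s))"
    by (rule continuous_on_compose2[OF c(1) continuous_on_Pair[OF continuous_on_const continuous_on_id]]) auto
  then have cm: "continuous_map (nsphere DIM('a)) (nsphere DIM('a)) (compactified_map \<phi> \<Omega> b)"
    unfolding nsphere_top continuous_map_subtopology_eu
    using c(2)[where t="0::real"] by (simp only: Pi_iff atLeastAtMost_iff split_conv) simp
  have "- \<Omega> \<noteq> {}" using *(1) not_bounded_UNIV by (metis Compl_UNIV_eq double_complement)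
  then have d: "infdist x (- \<Omega>) > 0" if "x \<in> \<Omega>" for x
    using in_closed_iff_infdist_zero[of "-\<Omega>" x] *(2) that infdist_nonneg[of x "- \<Omega>"] by fastforce
  have "compactified_map \<phi> \<Omega> b s \<noteq> to_sphere (0::'a)" for s
  proof
    assume e: "compactified_map \<phi> \<Omega> b s = to_sphere (0::'a)"
    then have x: "from_sphere s \<in> \<Omega>" and e': "to_sphere ((\<phi> (from_sphere s) - b) /\<^sub>R infdist (from_sphere s) (- \<Omega>)) = to_sphere (0::'a)"
      unfolding compactified_map_def Let_def using to_sphere_neq[of "0::'a"] by (auto split: if_splits)
    from arg_cong[OF e', of "from_sphere :: _ \<Rightarrow> 'a"] show False using no d[OF x] x by auto
  qed
  then have "to_sphere (0::'a) \<notin> compactified_map \<phi> \<Omega> b ` topspace (nsphere DIM('a))" by (metis imageE)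
  moreover have "to_sphere (0::'a) \<in> topspace (nsphere DIM('a))" unfolding nsphere_top using to_sphere_in[of "0::'a"] by simp
  ultimately have "compactified_map \<phi> \<Omega> b ` topspace (nsphere DIM('a)) \<noteq> topspace (nsphere DIM('a))" by metis
  then show False using Brouwer_degree2_nonsurjective[OF cm] assms(2) by (simp add: brouwer_degree_def)
qed

lemma brouwer_degree_id_0:
  assumes "bounded \<Omega>" "open \<Omega>" "(0::'a::euclidean_space) \<in> \<Omega>"
  shows "brouwer_degree (\<lambda>x. x) \<Omega> (0::'a) = 1"
proof -
  let ?F = "compactified_map (\<lambda>x. x) \<Omega> (0::'a)"
  let ?n = "DIM('a)"
  have *: "bounded \<Omega>" "open \<Omega>" "continuous_on ({0..1::real} \<times> closure \<Omega>) (\<lambda>(t,x). x)"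
    "continuous_on {0..1::real} (\<lambda>_. 0::'a)" "\<And>t x. t \<in> {0..1::real} \<Longrightarrow> x \<in> frontier \<Omega> \<Longrightarrow> x \<noteq> 0"
    using assms by (auto simp: case_prod_unfold frontier_def interior_open intro!: continuous_intros)
  note c = comp_homotopy_cont[where h = "\<lambda>_ x. x" and b = "\<lambda>_. 0", OF *]
  have "continuous_on (sph DIM('a)) (\<lambda>s. (\<lambda>(t::real,s). ?F s) (0,s))"
    by (rule continuous_on_compose2[OF c(1) continuous_on_Pair[OF continuous_on_const continuous_on_id]]) auto
  then have cF: "continuous_on (sph ?n) ?F" by simp
  have inF: "?F s \<in> sph ?n" if "s \<in> sph ?n" for s using c(2)[where t="0::real" and s=s] that by simp
  define G where "G t s i = (1 - t) * ?F s i + t * s i" for t s i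
  define N where "N t s = (\<Sum>i\<le>?n. (G t s i)^2)" for t s
  have inner: "(\<Sum>i\<le>?n. ?F s i * s i) > -1" if s: "s \<in> sph ?n" for s
  proof (cases "s \<noteq> sphere_pole ?n \<and> (from_sphere s :: 'a) \<in> \<Omega>")
    case True
    let ?x = "from_sphere s :: 'a"
    define d where "d = infdist ?x (- \<Omega>)"
    have "- \<Omega> \<noteq> {}" using assms(1) not_bounded_UNIV by (metis Compl_UNIV_eq double_complement)
    then have d: "d > 0"
      using in_closed_iff_infdist_zero[of "-\<Omega>" ?x] assms(2) True infdist_nonneg[of ?x "- \<Omega>"] unfolding d_def by fastforce
    have "?F s = to_sphere (?x /\<^sub>R d)"
      unfolding compactified_map_def Let_def d_def using True by simp
    then have F: "?F s = proj_point ?x d" using proj_point_to_sphere[OF d] by metis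
    have s1: "s = proj_point ?x 1" using to_from[OF s] True to_sphere_proj_point by metis
    let ?a = "(norm ?x)^2"
    have q: "?a + d^2 > 0" "?a + 1 > 0" using norm_sq_pos[of ?x d] norm_sq_pos[of ?x 1] d by auto
    have "(\<Sum>i\<le>?n. proj_point ?x d i * proj_point ?x 1 i) =
       (\<Sum>i<?n. (4*d/((?a + d^2)*(?a+1))) * (?x \<bullet> basis_enum i)^2) + (?a - d^2)*(?a-1)/((?a + d^2)*(?a+1))"
      unfolding lessThan_Suc_atMost[symmetric] sum.lessThan_Suc
      by (intro arg_cong2[where f = "(+)"] sum.cong) (auto simp: proj_point_def power2_eq_square)
    also have "\<dots> = (4*d * ?a + (?a - d^2)*(?a-1)) / ((?a + d^2)*(?a+1))"
      unfolding sum_distrib_left[symmetric] norm_enum by (simp add: add_divide_distrib)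
    also have "\<dots> > -1"
    proof -
      have "(?a - d^2)*(?a-1) + (?a + d^2)*(?a+1) = 2*(?a^2 + d^2)" by (simp add: algebra_simps power2_eq_square)
      moreover have "?a^2 + d^2 > 0" using d by (simp add: add_nonneg_pos)
      moreover have "4*d * ?a \<ge> 0" using d by simp
      moreover have "w + x > - y" if "x + y = 2 * z" "z > 0" "w \<ge> 0" for w x y z :: real using that by linarith
      ultimately have "4*d * ?a + (?a - d^2)*(?a-1) > - ((?a + d^2)*(?a+1))" by blast
      moreover have "(?a + d^2)*(?a+1) > 0" using q by simp
      ultimately show ?thesis by (simp add: less_divide_eq)
    qed
    finally show ?thesis using F s1 by simp
  next
    case False
    then have F: "?F s = sphere_pole ?n" by (auto simp: compactified_map_def)
    have "(\<Sum>i\<le>?n. ?F s i * s i) = s ?n" 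
      unfolding F lessThan_Suc_atMost[symmetric] by (simp add: sphere_pole_def)
    moreover have "s ?n > -1"
    proof -
      have 1: "(\<Sum>i<?n. (s i)^2) + (s ?n)^2 = 1" using s unfolding lessThan_Suc_atMost[symmetric] by simp
      have "(\<Sum>i<?n. (s i)^2) \<ge> 0" by (simp add: sum_nonneg)
      then have "(s ?n)^2 \<le> 1" using 1 by linarith
      then have "\<bar>s ?n\<bar> \<le> 1" by (simp add: abs_square_le_1)
      moreover have "s ?n \<noteq> -1"
      proof
        assume m: "s ?n = -1"
        then have "s \<noteq> sphere_pole ?n" by (auto simp: sphere_pole_def)
        with False have "(from_sphere s :: 'a) \<notin> \<Omega>" by blast
        moreover have "(norm (from_sphere s :: 'a))^2 = 0" using norm_from[OF s \<open>s \<noteq> _\<close>] m by simp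
        ultimately show False using assms(3) by simp
      qed
      ultimately show ?thesis by linarith
    qed
    ultimately show ?thesis by simp
  qed
  have N: "N t s > 0" if "t \<in> {0..1}" and s: "s \<in> sph ?n" for t s
  proof -
    have "N t s = (1-t)^2 * (\<Sum>i\<le>?n. (?F s i)^2) + t^2 * (\<Sum>i\<le>?n. (s i)^2) + 2*t*(1-t) * (\<Sum>i\<le>?n. ?F s i * s i)"
      unfolding N_def G_def sum_distrib_left sum.distrib[symmetric]
      by (intro sum.cong) (auto simp: power2_eq_square algebra_simps)
    then have e: "N t s = (1-t)^2 + t^2 + 2*t*(1-t) * (\<Sum>i\<le>?n. ?F s i * s i)"
      using inF[OF s] s by simp
    show ?thesis
    proof (cases "t = 0 \<or> t = 1")
      case True then show ?thesis using e by auto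
    next
      case False
      then have "2*t*(1-t) > 0" using that by auto
      then have "2*t*(1-t) * (\<Sum>i\<le>?n. ?F s i * s i) > 2*t*(1-t) * (-1)" using inner[OF s] mult_less_cancel_left_pos by blast
      moreover have "(1-t)^2 + t^2 + 2*t*(1-t) * (-1) = (1-2*t)^2" by (simp add: power2_eq_square algebra_simps)
      ultimately show ?thesis using e zero_le_power2[of "1-2*t"] by linarith
    qed
  qed
  have cG: "continuous_on ({0..1} \<times> sph ?n) (\<lambda>p. G (fst p) (snd p) i)" for i
  proof -
    have "continuous_on ({0..1::real} \<times> sph ?n) (\<lambda>p. ?F (snd p))"
      by (rule continuous_on_compose2[OF cF continuous_on_snd[OF continuous_on_id]]) auto
    then have "continuous_on ({0..1::real} \<times> sph ?n) (\<lambda>p. ?F (snd p) i)"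
      by (rule continuous_on_product_then_coordinatewise)
    moreover have "continuous_on ({0..1::real} \<times> sph ?n) (\<lambda>p. snd p i)"
      by (rule continuous_on_product_then_coordinatewise[OF continuous_on_snd[OF continuous_on_id]])
    ultimately show ?thesis unfolding G_def by (intro continuous_intros)
  qed
  have cN: "continuous_on ({0..1} \<times> sph ?n) (\<lambda>p. N (fst p) (snd p))"
    unfolding N_def by (intro continuous_intros cG)
  have cH: "continuous_on ({0..1} \<times> sph ?n) (\<lambda>p i. G (fst p) (snd p) i / sqrt (N (fst p) (snd p)))"
    by (intro continuous_on_coordinatewise_then_product continuous_intros cG cN) (use N in \<open>auto simp: less_le simp del: mem_Collect_eq\<close>)
  have inH: "(\<lambda>i. G t s i / sqrt (N t s)) \<in> sph ?n" if "t \<in> {0..1}" "s \<in> sph ?n" for t s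
  proof -
    have "(\<Sum>i\<le>?n. (G t s i / sqrt (N t s))^2) = N t s / N t s"
      using N[OF that] by (simp add: power_divide sum_divide_distrib[symmetric] N_def[symmetric])
    moreover have "G t s i = 0" if "i > ?n" for i using inF[OF \<open>s \<in> _\<close>] \<open>s \<in> _\<close> that unfolding G_def by simp
    ultimately show ?thesis using N[OF that] by simp
  qed
  have N01: "N 0 s = 1" "N 1 s = 1" if "s \<in> sph ?n" for s using inF[OF that] that by (auto simp: N_def G_def)
  have "homotopic_with_canon (\<lambda>x. True) (sph ?n) (sph ?n) ?F id"
  proof (rule homotopic_with_eq[where f = "\<lambda>s i. G 0 s i / sqrt (N 0 s)" and g = "\<lambda>s i. G 1 s i / sqrt (N 1 s)"])
    show "homotopic_with_canon (\<lambda>x. True) (sph ?n) (sph ?n) (\<lambda>s i. G 0 s i / sqrt (N 0 s)) (\<lambda>s i. G 1 s i / sqrt (N 1 s))"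
      by (rule homotopic_with_canon_TrueI[where F = "\<lambda>t s i. G t s i / sqrt (N t s)"])
         (use cH in \<open>simp only: case_prod_unfold\<close>, rule inH)
  qed (use N01 in \<open>auto simp: G_def\<close>)
  then have "Brouwer_degree2 ?n ?F = Brouwer_degree2 ?n id"
    by (intro Brouwer_degree2_homotopic) (simp add: nsphere_top)
  then show ?thesis by (simp add: brouwer_degree_def)
qed

end

(* Write \<Pi> for the projection onto K. A GVI solution is a zero of g(x) - \<Pi>(g(x) - f(x)), and this
   map is joined to g(x) - \<Pi>(xhat) by h_t(x) = g(x) - \<Pi>(t (g(x) - f(x)) + (1 - t) xhat). On the
   boundary of the set where |g| < r we have |g(x)| = r. If no h_t vanishes there, the degree is
   constant in t and a solution exists. Otherwise a boundary zero with 0 < t < 1 is a member of an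
   exceptional family, with \<alpha> = (1 - t) / t; t = 0 is excluded by r > |\<Pi>(xhat)|, and t = 1 gives a
   solution. Since |g(x_r)| = r, the family is unbounded. *)

theory Submission
  imports Defs
begin

lemma closest_point_normal_cone:
  assumes "closed K" "convex K" "K \<noteq> {}"
  shows "v - closest_point K v \<in> normal_cone K (closest_point K v)"
  using assms closest_point_in_set[of K v] closest_point_dot[of K _ v]
  by (auto simp: normal_cone_def)

lemma normal_cone_scaleR:
  "u \<in> normal_cone K z \<Longrightarrow> c \<ge> 0 \<Longrightarrow> c *\<^sub>R u \<in> normal_cone K z"
  by (auto simp: normal_cone_def mult_nonneg_nonpos split: if_splits)

lemma GVI_solution_iff_normal_cone:
  "GVI_solution f g K x \<longleftrightarrow> - f x \<in> normal_cone K (g x)"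
  by (auto simp: GVI_solution_def normal_cone_def)

text \<open>The sublevel set is open, so its frontier avoids it, while its closure stays in the
  closed sublevel set.\<close>

lemma frontier_norm_sublevel:
  assumes "continuous_on UNIV g" "x \<in> frontier {x. norm (g x) < r}"
  shows "norm (g x) = r"
proof -
  have op: "open {x. norm (g x) < r}" and cl: "closed {x. norm (g x) \<le> r}"
    using assms(1) by (auto intro!: open_Collect_less closed_Collect_le continuous_intros)
  have "closure {x. norm (g x) < r} \<subseteq> {x. norm (g x) \<le> r}"
    by (rule closure_minimal[OF _ cl]) auto
  then show ?thesis
    using assms(2) op by (force simp: frontier_def interior_open)
qed

text \<open>Closed balls are compact in finite dimension, so \<open>g\<close> is bounded on each of
  them; large values of \<open>g\<close> therefore force the argument out of any given ball.\<close>

lemma filterlim_norm_at_top_of_image: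
  fixes g :: "'a::euclidean_space \<Rightarrow> 'b::real_normed_vector"
  assumes "continuous_on UNIV g" and lim: "filterlim (\<lambda>r. norm (g (x r))) at_top F"
  shows "filterlim (\<lambda>r. norm (x r)) at_top F"
  unfolding filterlim_at_top
proof
  fix Z :: real
  have "compact (g ` cball 0 Z)"
    using assms(1) by (intro compact_continuous_image) (auto intro: continuous_on_subset)
  then obtain B where B: "norm (g y) \<le> B" if "norm y \<le> Z" for y
    using compact_imp_bounded bounded_iff by (metis imageI mem_cball_0)
  have "\<forall>\<^sub>F r in F. B < norm (g (x r))"
    using lim by (simp add: filterlim_at_top_dense)
  then show "\<forall>\<^sub>F r in F. Z \<le> norm (x r)"
    by eventually_elim (metis B linear not_less)
qed

text \<open>Supplies the family member for a single \<open>r\<close>. The exact value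
  \<open>norm (g x) = r\<close> is what later drives the family to infinity.\<close>

lemma exceptional_point_on_level:
  fixes C K :: "'a::euclidean_space set"
  assumes C: "closed C" "convex C" "C \<noteq> {}"
    and K: "K \<noteq> {}" "closed K" "convex K"
    and g: "continuous_on UNIV g" and f: "continuous_on C f" and gC: "g -` K \<subseteq> C"
    and r: "norm (closest_point K xhat) < r"
    and dd: "degree_defined g {x. norm (g x) < r} (closest_point K xhat)"
    and dn: "brouwer_degree g {x. norm (g x) < r} (closest_point K xhat) \<noteq> 0"
    and no: "\<nexists>x. GVI_solution f g K x"
  shows "\<exists>x. g x \<in> K \<and> norm (g x) = r \<and>
    (\<exists>\<alpha>>0. - (f x + \<alpha> *\<^sub>R (g x - xhat)) \<in> normal_cone K (g x))"
proof -
  define p where "p = closest_point K xhat"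
  define \<Omega> where "\<Omega> = {x. norm (g x) < r}"
  define F where "F = f \<circ> closest_point C"
  define v where "v t x = t *\<^sub>R (g x - F x) + (1 - t) *\<^sub>R xhat" for t x
  \<comment> \<open>Adding \<open>p\<close> makes \<open>h 0\<close> equal to \<open>g\<close>, so
    the degree hypothesis applies directly, with the target \<open>p\<close> fixed for all
    \<open>t\<close>.\<close>
  define h where "h t x = g x - closest_point K (v t x) + p" for t x
  have \<Omega>: "bounded \<Omega>" "open \<Omega>"
    using dd by (auto simp: degree_defined_def \<Omega>_def)
  have "continuous_on UNIV F"
    unfolding F_def using C closest_point_in_set[OF C(1,3)]
    by (intro continuous_on_compose continuous_on_closest_point continuous_on_subset[OF f]) auto
  then have cF: "continuous_on S (\<lambda>z. F (snd z))" for S :: "(real \<times> 'a) set"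
    by (rule continuous_on_compose2) (auto intro: continuous_intros)
  have cg: "continuous_on S (\<lambda>z. g (snd z))" for S :: "(real \<times> 'a) set"
    by (rule continuous_on_compose2[OF g]) (auto intro: continuous_intros)
  have "continuous_on S (\<lambda>z. closest_point K (v (fst z) (snd z)))" for S
    by (rule continuous_on_compose2[OF continuous_on_closest_point[OF K(3,2,1), of UNIV]])
      (auto simp: v_def intro!: continuous_intros cF cg)
  then have ch: "continuous_on ({0..1} \<times> closure \<Omega>) (\<lambda>(t, x). h t x)"
    unfolding case_prod_unfold h_def by (intro continuous_intros cg)
  \<comment> \<open>If \<open>h t x = p\<close>, then \<open>g x\<close> is the projection of
    \<open>v t x\<close>, and the residual \<open>v t x - g x\<close> is normal to \<open>K\<close>
    there.\<close>
  have zero: "g x \<in> K" "- (t *\<^sub>R f x + (1 - t) *\<^sub>R (g x - xhat)) \<in> normal_cone K (g x)"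
    if "h t x = p" for t x
  proof -
    have gx: "g x = closest_point K (v t x)"
      using that by (simp add: h_def)
    show inK: "g x \<in> K"
      unfolding gx using K closest_point_in_set by blast
    have "F x = f x"
      using inK gC closest_point_self[of x C] by (auto simp: F_def)
    then have "v t x - g x = - (t *\<^sub>R f x + (1 - t) *\<^sub>R (g x - xhat))"
      by (simp add: v_def algebra_simps)
    moreover have "v t x - g x \<in> normal_cone K (g x)"
      unfolding gx using closest_point_normal_cone K by blast
    ultimately show "- (t *\<^sub>R f x + (1 - t) *\<^sub>R (g x - xhat)) \<in> normal_cone K (g x)"
      by simp
  qed
  have no1: "h 1 x \<noteq> p" for x
    using zero(2)[of 1 x] no by (auto simp: GVI_solution_iff_normal_cone)
  have h0: "h 0 = g"
    by (simp add: h_def v_def p_def fun_eq_iff)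
  have "\<exists>t\<in>{0..1}. \<exists>x\<in>frontier \<Omega>. h t x = p"
  proof (rule ccontr)
    assume nz: "\<not> ?thesis"
    have "brouwer_degree (h 0) \<Omega> p = brouwer_degree (h 1) \<Omega> p"
      by (rule brouwer_degree_homotopy[where h = h and b = "\<lambda>_. p", OF \<Omega> ch])
        (use nz in auto)
    then have "brouwer_degree (h 1) \<Omega> p \<noteq> 0"
      using dn by (simp add: h0 p_def \<Omega>_def)
    \<comment> \<open>Slicing the joint continuity at \<open>t = 1\<close> shows that the degree of
      \<open>h 1\<close> is defined.\<close>
    moreover have "continuous_on (closure \<Omega>) (\<lambda>x. (\<lambda>(t, x). h t x) (1, x))"
      by (rule continuous_on_compose2[OF ch]) (auto intro!: continuous_intros)
    then have "degree_defined (h 1) \<Omega> p"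
      using \<Omega> no1 by (auto simp: degree_defined_def dest: sym)
    ultimately show False
      using brouwer_degree_solution no1 by blast
  qed
  then obtain t x where t: "t \<in> {0..1}" and x: "x \<in> frontier \<Omega>" and hx: "h t x = p"
    by blast
  have nx: "norm (g x) = r"
    using frontier_norm_sublevel[OF g] x unfolding \<Omega>_def by blast
  \<comment> \<open>For \<open>t = 0\<close> the equation reads \<open>g x = p\<close>, but
    \<open>norm p < r = norm (g x)\<close>.\<close>
  have "t \<noteq> 0" "t \<noteq> 1"
    using hx h0 nx r no1 by (auto simp: p_def)
  with t have t01: "0 < t" "t < 1"
    by auto
  have "(1 / t) *\<^sub>R - (t *\<^sub>R f x + (1 - t) *\<^sub>R (g x - xhat)) \<in> normal_cone K (g x)"
    using zero(2)[OF hx] t01 by (intro normal_cone_scaleR) auto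
  moreover have "(1 / t) *\<^sub>R - (t *\<^sub>R f x + (1 - t) *\<^sub>R (g x - xhat))
      = - (f x + ((1 - t) / t) *\<^sub>R (g x - xhat))"
    using t01 by (simp add: scaleR_add_right scaleR_diff_right)
  moreover have "(1 - t) / t > 0"
    using t01 by simp
  ultimately show ?thesis
    using zero(1)[OF hx] nx by metis
qed

theorem mainTheorem2:
  fixes C K :: "'a::euclidean_space set"
    and f g :: "'a \<Rightarrow> 'a"
  assumes "closed C" and "convex_cone C"
    and "K \<noteq> {}" and "closed K" and "convex K"
    and "continuous_on UNIV g" and "continuous_on C f"
    and "g -` K \<subseteq> C"
    and a: "\<forall>M\<ge>0. bounded {x. norm (g x) \<le> M}"
    and b: "\<forall>xhat. \<forall>r>norm (closest_point K xhat).
              degree_defined g {x. norm (g x) < r} (closest_point K xhat) \<and>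
              brouwer_degree g {x. norm (g x) < r} (closest_point K xhat) \<noteq> 0"
  shows "\<forall>xhat. (\<exists>x. GVI_solution f g K x) \<or>
                (\<exists>x. exceptional_family f g C K xhat x)"
\<comment> \<open>The swap makes \<open>disjCI\<close> assume that there is no solution.\<close>
proof (intro allI, subst disj_commute, rule disjCI)
  fix xhat
  assume no: "\<nexists>x. GVI_solution f g K x"
  define R where "R = norm (closest_point K xhat)"
  have C: "convex C" "C \<noteq> {}"
    using \<open>convex_cone C\<close> by (auto simp: convex_cone_def)
  have "\<exists>x. g x \<in> K \<and> norm (g x) = r \<and>
      (\<exists>\<alpha>>0. - (f x + \<alpha> *\<^sub>R (g x - xhat)) \<in> normal_cone K (g x))" if "r > R" for r
    using that b no assms C unfolding R_def
    by (intro exceptional_point_on_level[of C K g f xhat r]) auto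
  then obtain x where x: "g (x r) \<in> K" "norm (g (x r)) = r"
      "\<exists>\<alpha>>0. - (f (x r) + \<alpha> *\<^sub>R (g (x r) - xhat)) \<in> normal_cone K (g (x r))" if "r > R" for r
    by metis
  \<comment> \<open>Conditions (i) and (iii) do not constrain indices \<open>r \<le> R\<close>; there any point of \<open>g -` K\<close> will do.\<close>
  define y where "y r = (if r > R then x r else x (R + 1))" for r
  have yK: "g (y r) \<in> K" for r
    using x(1) by (simp add: y_def)
  \<comment> \<open>The equality may fail for \<open>r \<le> R\<close>, which does not affect the
    limit.\<close>
  have "\<forall>\<^sub>F r in at_top. norm (g (y r)) = r"
    using eventually_gt_at_top[of R] by eventually_elim (simp add: y_def x(2))
  then have "filterlim (\<lambda>r. norm (g (y r))) at_top at_top"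
    by (simp add: filterlim_cong[OF refl refl] filterlim_ident)
  then have "filterlim (\<lambda>r. norm (y r)) at_top at_top"
    using filterlim_norm_at_top_of_image \<open>continuous_on UNIV g\<close> by blast
  moreover have "y r \<in> C" for r
    using yK \<open>g -` K \<subseteq> C\<close> by blast
  ultimately have "exceptional_family f g C K xhat y"
    using yK x(3) by (simp add: exceptional_family_def R_def[symmetric] y_def)
  then show "\<exists>x. exceptional_family f g C K xhat x" by blast
qed

end
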